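(* $f(2)=2$, $f(3)=4$, and $f(d)=2^{d}$ for every integer $d\ge 4$.
   Context: Graphs are finite and simple. Let $H=(V,E)$ be a graph. A spanning subgraph of $H$ is identified with its edge set $A\subseteq E$ (its vertex set is all of $V$); it is called connected and spanning if the graph $(V,A)$ is connected. A family $\mathcal{C}\subseteq 2^{E}$ is a connectivity code for $H$ if for all distinct $A,B\in\mathcal{C}$ the symmetric difference $A\triangle B$ is a connected spanning subgraph of $H$. The maximum cardinality of a connectivity code for $H$ is denoted $m(H)$. For $d\ge 2$, $$f(d)=\max\{\,q : m(H)=q \text{ for infinitely many pairwise nonisomorphic } d\text{-regular graphs } H\,\}.$$ *)

theory Defs
  imports Main
begin

type_synonym 'a graph = "'a set \<times> 'a set set"

abbreviation verts :: "'a graph \<Rightarrow> 'a set" where "verts \<equiv> fst"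
abbreviation edges :: "'a graph \<Rightarrow> 'a set set" where "edges \<equiv> snd"

definition simple_graph :: "'a graph \<Rightarrow> bool" where
  "simple_graph G \<longleftrightarrow> finite (verts G) \<and> (\<forall>e\<in>edges G. e \<subseteq> verts G \<and> card e = 2)"

definition degree :: "'a graph \<Rightarrow> 'a \<Rightarrow> nat" where
  "degree G v = card {e \<in> edges G. v \<in> e}"

definition regular :: "nat \<Rightarrow> 'a graph \<Rightarrow> bool" where
  "regular d G \<longleftrightarrow> (\<forall>v\<in>verts G. degree G v = d)"

definition isomorphic :: "'a graph \<Rightarrow> 'b graph \<Rightarrow> bool" where
  "isomorphic G H \<longleftrightarrow> (\<exists>\<phi>. bij_betw \<phi> (verts G) (verts H) \<and>
     (\<forall>u\<in>verts G. \<forall>v\<in>verts G. {u, v} \<in> edges G \<longleftrightarrow> {\<phi> u, \<phi> v} \<in> edges H))"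

text \<open>A spanning subgraph is given by its edge set \<open>A\<close> alone; its vertex set is all of
  \<^term>\<open>verts G\<close>, so isolated vertices destroy connectedness.\<close>

definition connected_spanning :: "'a graph \<Rightarrow> 'a set set \<Rightarrow> bool" where
  "connected_spanning G A \<longleftrightarrow> A \<subseteq> edges G \<and>
     (\<forall>u\<in>verts G. \<forall>v\<in>verts G. (u, v) \<in> {(x, y). {x, y} \<in> A}\<^sup>*)"

definition connectivity_code :: "'a graph \<Rightarrow> 'a set set set \<Rightarrow> bool" where
  "connectivity_code G C \<longleftrightarrow> C \<subseteq> Pow (edges G) \<and>
     (\<forall>A\<in>C. \<forall>B\<in>C. A \<noteq> B \<longrightarrow> connected_spanning G (sym_diff A B))"

definition max_code :: "'a graph \<Rightarrow> nat" where
  "max_code G = Max {card C | C. connectivity_code G C}"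

text \<open>The maximum in \<^const>\<open>max_code\<close> is over a finite nonempty set.\<close>

lemma finite_edges:
  assumes "simple_graph G"
  shows "finite (edges G)"
  using assms unfolding simple_graph_def
  by (meson Pow_iff finite_Pow_iff finite_subset subsetI)

lemma max_code_well_defined:
  assumes "simple_graph G"
  shows "finite {card C | C. connectivity_code G C}" "{card C | C. connectivity_code G C} \<noteq> {}"
proof -
  have "{card C | C. connectivity_code G C} \<subseteq> card ` Pow (Pow (edges G))"
    unfolding connectivity_code_def by blast
  then show "finite {card C | C. connectivity_code G C}"
    using finite_edges[OF assms] by (meson finite_Pow_iff finite_imageI finite_subset)
  have "connectivity_code G {}"
    by (simp add: connectivity_code_def)
  then show "{card C | C. connectivity_code G C} \<noteq> {}"
    by blast
qed

text \<open>Every finite graph is isomorphic to one with vertices in \<^typ>\<open>nat\<close>, so it suffices to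
  consider such graphs when counting isomorphism types.\<close>

definition recurrent_max_codes :: "nat \<Rightarrow> nat set" where
  "recurrent_max_codes d = {q. \<exists>F :: nat graph set. infinite F \<and>
     (\<forall>G\<in>F. simple_graph G \<and> regular d G \<and> max_code G = q) \<and>
     (\<forall>G\<in>F. \<forall>H\<in>F. G \<noteq> H \<longrightarrow> \<not> isomorphic G H)}"

text \<open>\<^const>\<open>Max\<close> is unspecified on infinite or empty sets, so a statement about the following
  function should also assert that \<^term>\<open>recurrent_max_codes d\<close> is finite and nonempty.\<close>

definition f_max :: "nat \<Rightarrow> nat" where
  "f_max d = Max (recurrent_max_codes d)"

end

theory Submission
  imports Defs
begin

text \<open>The symmetric difference of two code words meets the star of every vertex, so restricting a code
  to one star is injective and a code in a \<open>d\<close>-regular graph has at most \<open>2\<^sup>d\<close> words. For \<open>d \<le> 3\<close> more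
  is true in large graphs: the symmetric differences of three (five) words have at least \<open>n - 1\<close> edges
  each, whereas every edge lies in at most 2 of 3 (6 of 10) of them.

  Codes attaining the bounds consist of unions of edge classes in graphs on \<open>\<int>/4N\<close> that are invariant
  under translation by 4: the cycle, the cycle with the chords \<open>{x, x + 3}\<close> for even \<open>x\<close>, and the circulant
  graph with steps 1 and 3. A code of size \<open>2\<^sup>d\<close> yields one of size \<open>2\<^bsup>d+1\<^esup>\<close>: take three copies of the graph,
  let copy \<open>i\<close> use the word obtained by deleting coordinate \<open>i\<close>, and join half of each copy to half of
  the next one by a matching. If two words differ only in coordinate \<open>i\<close>, then copy \<open>i\<close> contributes
  nothing to their difference, but all matching edges at copy \<open>i\<close> do.\<close>

section \<open>Counting bounds\<close>

definition adj :: "'a set set \<Rightarrow> ('a \<times> 'a) set" where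
  "adj A = {(x, y). {x, y} \<in> A}"

lemma connected_spanning_adj:
  "connected_spanning G A \<longleftrightarrow>
     A \<subseteq> edges G \<and> (\<forall>u\<in>verts G. \<forall>v\<in>verts G. (u, v) \<in> (adj A)\<^sup>*)"
  by (simp add: connected_spanning_def adj_def)

lemma sym_rtrancl_adj: "sym ((adj A)\<^sup>*)"
  by (intro sym_rtrancl) (auto simp: sym_def adj_def insert_commute)

text \<open>Root the graph at \<open>r\<close> and send every other vertex to an edge leading to a
  vertex of smaller distance from \<open>r\<close>. This map is injective: if two vertices shared an
  edge, each would be closer to \<open>r\<close> than the other.\<close>

lemma card_verts_le_connected:
  assumes G: "simple_graph G" and con: "connected_spanning G A"
  shows "card (verts G) \<le> card A + 1"
proof (cases "verts G = {}")
  case False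
  then obtain r where r: "r \<in> verts G" by blast
  have AE: "A \<subseteq> edges G" and reach: "\<And>v. v \<in> verts G \<Longrightarrow> (r, v) \<in> (adj A)\<^sup>*"
    using con r by (auto simp: connected_spanning_adj)
  have finA: "finite A"
    using AE finite_edges[OF G] finite_subset by blast
  define dist where "dist v = (LEAST k. (r, v) \<in> adj A ^^ k)" for v
  have dist: "(r, v) \<in> adj A ^^ dist v" if "v \<in> verts G" for v
    unfolding dist_def using reach[OF that] by (metis LeastI rtrancl_imp_relpow)
  have "\<exists>y. {y, v} \<in> A \<and> dist y < dist v" if v: "v \<in> verts G - {r}" for v
  proof (cases "dist v")
    case 0
    then show ?thesis using dist[of v] v by auto
  next
    case (Suc k)
    then have "(r, v) \<in> adj A ^^ Suc k"
      using dist[of v] v by simp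
    then obtain y where y: "(r, y) \<in> adj A ^^ k" "(y, v) \<in> adj A"
      by auto
    have "dist y \<le> k"
      unfolding dist_def using y(1) by (rule Least_le)
    then show ?thesis using y(2) Suc by (auto simp: adj_def)
  qed
  then obtain par where par: "\<And>v. v \<in> verts G - {r} \<Longrightarrow> {par v, v} \<in> A \<and> dist (par v) < dist v"
    by metis
  have "inj_on (\<lambda>v. {par v, v}) (verts G - {r})"
    by (intro inj_onI) (metis doubleton_eq_iff less_asym par)
  then have "card (verts G - {r}) \<le> card A"
    using par finA by (intro card_inj_on_le[where f = "\<lambda>v. {par v, v}"]) auto
  then show ?thesis
    using r by (simp add: card_Diff_singleton_if)
qed simp

lemma handshake:
  assumes "simple_graph G"
  shows "(\<Sum>v\<in>verts G. degree G v) = 2 * card (edges G)"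
proof -
  have fin: "finite (verts G)" "finite (edges G)"
    using assms finite_edges[OF assms] by (simp_all add: simple_graph_def)
  have "(\<Sum>v\<in>verts G. degree G v) = (\<Sum>v\<in>verts G. \<Sum>e\<in>edges G. if v \<in> e then 1 else 0)"
    using fin by (simp add: degree_def sum.If_cases Int_def)
  also have "\<dots> = (\<Sum>e\<in>edges G. \<Sum>v\<in>verts G. if v \<in> e then 1 else 0)"
    by (rule sum.swap)
  also have "\<dots> = (\<Sum>e\<in>edges G. 2)"
  proof (rule sum.cong)
    fix e assume "e \<in> edges G"
    then have "verts G \<inter> e = e" "card e = 2"
      using assms by (auto simp: simple_graph_def)
    then show "(\<Sum>v\<in>verts G. if v \<in> e then 1 else 0) = (2::nat)"
      using fin by (simp add: sum.If_cases Int_def)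
  qed simp
  finally show ?thesis by simp
qed

text \<open>Double counting of the triples \<open>(A, B, e)\<close> with \<open>e \<in> A \<triangle> B\<close>.\<close>

lemma code_counting:
  assumes G: "simple_graph G" and code: "connectivity_code G C"
    and bound: "\<And>a. a \<le> card C \<Longrightarrow> a * (card C - a) \<le> b"
  shows "card C * (card C - 1) * (card (verts G) - 1) \<le> 2 * b * card (edges G)"
proof -
  have finE: "finite (edges G)" by (rule finite_edges[OF G])
  have CE: "A \<subseteq> edges G" if "A \<in> C" for A
    using code that by (auto simp: connectivity_code_def)
  have finC: "finite C"
    using finE code by (auto simp: connectivity_code_def intro: finite_subset)
  have "card C * (card C - 1) * (card (verts G) - 1)
      = (\<Sum>A\<in>C. \<Sum>B\<in>C - {A}. card (verts G) - 1)"
    by (simp add: finC)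
  also have "\<dots> \<le> (\<Sum>A\<in>C. \<Sum>B\<in>C - {A}. card (sym_diff A B))"
  proof (intro sum_mono)
    fix A B assume "A \<in> C" "B \<in> C - {A}"
    then have "connected_spanning G (sym_diff A B)"
      using code by (auto simp: connectivity_code_def)
    from card_verts_le_connected[OF G this]
    show "card (verts G) - 1 \<le> card (sym_diff A B)" by simp
  qed
  also have "\<dots> \<le> (\<Sum>A\<in>C. \<Sum>B\<in>C. card (sym_diff A B))"
    by (intro sum_mono sum_mono2) (auto simp: finC)
  also have "\<dots> = (\<Sum>A\<in>C. \<Sum>B\<in>C. \<Sum>e\<in>edges G. if e \<in> sym_diff A B then 1 else 0)"
  proof (intro sum.cong refl)
    fix A B assume "A \<in> C" "B \<in> C"
    then have "{e \<in> edges G. e \<in> sym_diff A B} = sym_diff A B"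
      using CE by blast
    then show "card (sym_diff A B) = (\<Sum>e\<in>edges G. if e \<in> sym_diff A B then 1 else 0)"
      using finE by (simp add: sum.If_cases Int_def)
  qed
  also have "\<dots> = (\<Sum>A\<in>C. \<Sum>e\<in>edges G. \<Sum>B\<in>C. if e \<in> sym_diff A B then 1 else 0)"
    by (intro sum.cong refl sum.swap)
  also have "\<dots> = (\<Sum>e\<in>edges G. \<Sum>A\<in>C. \<Sum>B\<in>C. if e \<in> sym_diff A B then 1 else 0)"
    by (rule sum.swap)
  also have "\<dots> \<le> (\<Sum>e\<in>edges G. 2 * b)"
  proof (rule sum_mono)
    fix e
    define a where "a = card {A \<in> C. e \<in> A}"
    have a: "a \<le> card C"
      unfolding a_def by (intro card_mono finC) auto
    have a': "card {A \<in> C. e \<notin> A} = card C - a"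
    proof -
      have "{A \<in> C. e \<notin> A} = C - {A \<in> C. e \<in> A}" by auto
      then show ?thesis
        unfolding a_def using finC by (simp add: card_Diff_subset)
    qed
    have "(\<Sum>B\<in>C. if e \<in> sym_diff A B then 1 else 0) = (if e \<in> A then card C - a else a)" for A
    proof (cases "e \<in> A")
      case True
      then have "{B \<in> C. e \<in> sym_diff A B} = {A \<in> C. e \<notin> A}" by auto
      then show ?thesis using True finC a' by (simp add: sum.If_cases Int_def)
    next
      case False
      then have "{B \<in> C. e \<in> sym_diff A B} = {A \<in> C. e \<in> A}" by auto
      then show ?thesis using False finC by (simp add: sum.If_cases Int_def a_def)
    qed
    then have "(\<Sum>A\<in>C. \<Sum>B\<in>C. if e \<in> sym_diff A B then 1 else 0)
        = (\<Sum>A\<in>C. if e \<in> A then card C - a else a)" by simp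
    also have "\<dots> = 2 * (a * (card C - a))"
      using a' by (simp add: sum.If_cases finC Int_def a_def Collect_neg_eq[symmetric])
    also have "\<dots> \<le> 2 * b"
      using bound[OF a] by simp
    finally show "(\<Sum>A\<in>C. \<Sum>B\<in>C. if e \<in> sym_diff A B then 1 else 0) \<le> 2 * b" .
  qed
  finally show ?thesis by (simp add: mult.commute)
qed

lemma max_code_le:
  assumes "simple_graph G" "\<And>C. connectivity_code G C \<Longrightarrow> card C \<le> q"
  shows "max_code G \<le> q"
  unfolding max_code_def using max_code_well_defined[OF assms(1)] assms(2)
  by (intro Max.boundedI) auto

lemma max_code_ge:
  assumes "simple_graph G" "connectivity_code G C"
  shows "card C \<le> max_code G"
  unfolding max_code_def using max_code_well_defined[OF assms(1)] assms(2)
  by (intro Max_ge) auto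

lemma connectivity_code_subset:
  "connectivity_code G C \<Longrightarrow> C' \<subseteq> C \<Longrightarrow> connectivity_code G C'"
  unfolding connectivity_code_def by blast

text \<open>A code that is too large contains one with exactly \<open>c\<close> words, for which
  \<open>code_counting\<close> and the handshake identity contradict \<open>big\<close>.\<close>

lemma max_code_le_of_counting:
  assumes G: "simple_graph G" and reg: "regular d G"
    and bound: "\<And>a. a \<le> c \<Longrightarrow> a * (c - a) \<le> b"
    and big: "b * d * card (verts G) < c * (c - 1) * (card (verts G) - 1)"
  shows "max_code G \<le> c - 1"
proof (rule max_code_le[OF G], rule ccontr)
  fix C assume C: "connectivity_code G C" "\<not> card C \<le> c - 1"
  from C(2) have "c \<le> card C" by linarith
  then obtain C' where C': "C' \<subseteq> C" "card C' = c"
    by (metis obtain_subset_with_card_n)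
  have "2 * card (edges G) = d * card (verts G)"
    using handshake[OF G] reg by (simp add: regular_def mult.commute)
  moreover have "c * (c - 1) * (card (verts G) - 1) \<le> 2 * b * card (edges G)"
    using code_counting[OF G connectivity_code_subset[OF C(1) C'(1)], of b] bound C'(2) by simp
  ultimately show False
    using big by (simp add: mult.assoc mult.left_commute)
qed

text \<open>With \<open>c = 3\<close> and \<open>b = 2\<close> the inequality \<open>big\<close>
  reads 4n < 6(n - 1), that is n > 3. The triangle is a true exception: its edge sets of even size
  form a code with four words.\<close>

lemma max_code_le_two:
  assumes "simple_graph G" "regular 2 G" "3 < card (verts G)"
  shows "max_code G \<le> 2"
proof -
  have "a * (3 - a) \<le> 2" if "a \<le> 3" for a :: nat
  proof -
    from that consider "a = 0" | "a = 1" | "a = 2" | "a = 3" by linarith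
    then show ?thesis by cases auto
  qed
  then show ?thesis
    using max_code_le_of_counting[OF assms(1,2), of 3 2] assms(3) by simp
qed

text \<open>With \<open>c = 5\<close> and \<open>b = 6\<close> the inequality \<open>big\<close>
  reads 18n < 20(n - 1), that is n > 10.\<close>

lemma max_code_le_four:
  assumes "simple_graph G" "regular 3 G" "10 < card (verts G)"
  shows "max_code G \<le> 4"
proof -
  have "a * (5 - a) \<le> 6" if "a \<le> 5" for a :: nat
  proof -
    from that consider "a = 0" | "a = 1" | "a = 2" | "a = 3" | "a = 4" | "a = 5" by linarith
    then show ?thesis by cases auto
  qed
  then show ?thesis
    using max_code_le_of_counting[OF assms(1,2), of 5 6] assms(3) by simp
qed

lemma max_code_le_power:
  assumes G: "simple_graph G" and reg: "regular d G" and d: "d > 0"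
  shows "max_code G \<le> 2 ^ d"
proof (rule max_code_le[OF G])
  fix C assume C: "connectivity_code G C"
  show "card C \<le> 2 ^ d"
  proof (cases "verts G = {}")
    case True
    then have "edges G = {}"
      using G by (fastforce simp: simple_graph_def)
    then have "C \<subseteq> {{}}"
      using C by (auto simp: connectivity_code_def)
    then have "card C \<le> card {{} :: 'a set set}"
      by (intro card_mono) auto
    then show ?thesis
      by (simp add: order_trans[OF _ one_le_power])
  next
    case False
    then obtain v where v: "v \<in> verts G" by blast
    define st where "st = {e \<in> edges G. v \<in> e}"
    have st: "card st = d"
      using reg v by (simp add: st_def regular_def degree_def)
    then have fin: "finite st" using d by (metis card.infinite less_nat_zero_code)
    \<comment> \<open>Positive degree provides a second vertex, so every connected spanning subgraph
      has an edge at \<open>v\<close>.\<close>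
    have "st \<noteq> {}" using st d by auto
    then obtain e where e: "e \<in> edges G" "v \<in> e"
      by (auto simp: st_def)
    then have "e \<subseteq> verts G" "card e = 2"
      using G by (auto simp: simple_graph_def)
    then obtain u where u: "u \<in> verts G" "u \<noteq> v"
      by (metis card_2_iff insert_subset)
    have "inj_on (\<lambda>A. A \<inter> st) C"
    proof (intro inj_onI, rule ccontr)
      fix A B assume AB: "A \<in> C" "B \<in> C" "A \<inter> st = B \<inter> st" "A \<noteq> B"
      then have con: "connected_spanning G (sym_diff A B)"
        using C by (auto simp: connectivity_code_def)
      then have "(v, u) \<in> (adj (sym_diff A B))\<^sup>*"
        using u v by (simp add: connected_spanning_adj)
      then obtain y where "(v, y) \<in> adj (sym_diff A B)"
        using u(2) by (metis converse_rtranclE)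
      then show False
        using AB(3) con by (auto simp: adj_def st_def connected_spanning_def)
    qed
    then have "card C \<le> card (Pow st)"
      using fin by (intro card_inj_on_le[where f = "\<lambda>A. A \<inter> st"]) auto
    then show ?thesis using fin st by (simp add: card_Pow)
  qed
qed

section \<open>Values attained by infinitely many graphs\<close>

text \<open>Only finitely many isomorphism types have at most \<open>n\<close> vertices: after
  numbering the vertices, the order and the adjacency relation on the numbers determine the
  type.\<close>

lemma infinite_nonisomorphic_card_gt:
  fixes F :: "'a graph set"
  assumes inf: "infinite F" and simple: "\<And>G. G \<in> F \<Longrightarrow> simple_graph G"
    and noniso: "\<And>G H. G \<in> F \<Longrightarrow> H \<in> F \<Longrightarrow> G \<noteq> H \<Longrightarrow> \<not> isomorphic G H"
  shows "\<exists>G\<in>F. card (verts G) > n"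
proof (rule ccontr)
  assume "\<not> ?thesis"
  then have small: "card (verts G) \<le> n" if "G \<in> F" for G using that by force
  have "\<exists>h. bij_betw h (verts G) {..<card (verts G)}" if "G \<in> F" for G
    using simple[OF that] ex_bij_betw_finite_nat
    by (auto simp: simple_graph_def atLeast0LessThan)
  then obtain h where h: "\<And>G. G \<in> F \<Longrightarrow> bij_betw (h G) (verts G) {..<card (verts G)}"
    by metis
  define code where
    "code G = (card (verts G), {(i, j) |i j u v. u \<in> verts G \<and> v \<in> verts G \<and> {u, v} \<in> edges G \<and>
       i = h G u \<and> j = h G v})" for G
  have "code ` F \<subseteq> {..n} \<times> Pow ({..<n} \<times> {..<n})"
  proof
    fix c assume "c \<in> code ` F"
    then obtain G where G: "G \<in> F" "c = code G" by blast
    have "h G u < n" if "u \<in> verts G" for u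
      using bij_betw_apply[OF h[OF G(1)] that] small[OF G(1)] by simp
    then show "c \<in> {..n} \<times> Pow ({..<n} \<times> {..<n})"
      using G small[OF G(1)] by (auto simp: code_def)
  qed
  moreover have "inj_on code F"
  proof (intro inj_onI, rule ccontr)
    fix G H assume GH: "G \<in> F" "H \<in> F" "code G = code H" "G \<noteq> H"
    have c: "card (verts G) = card (verts H)"
      and e: "{(i, j) |i j u v. u \<in> verts G \<and> v \<in> verts G \<and> {u, v} \<in> edges G \<and> i = h G u \<and> j = h G v}
        = {(i, j) |i j u v. u \<in> verts H \<and> v \<in> verts H \<and> {u, v} \<in> edges H \<and> i = h H u \<and> j = h H v}"
      using GH(3) by (simp_all add: code_def)
    define k where "k = inv_into (verts H) (h H)"
    have k: "bij_betw k {..<card (verts G)} (verts H)"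
      unfolding k_def c by (intro bij_betw_inv_into h GH)
    have hk: "h H (k i) = i" if "i < card (verts G)" for i
      unfolding k_def using that h[OF GH(2)] c by (simp add: bij_betw_inv_into_right)
    \<comment> \<open>Number the vertices as in \<open>G\<close>, then read the numbers back in
      \<open>H\<close>; equality of the codes makes this an isomorphism.\<close>
    define \<phi> where "\<phi> = k \<circ> h G"
    have bij: "bij_betw \<phi> (verts G) (verts H)"
      unfolding \<phi>_def by (rule bij_betw_trans[OF h[OF GH(1)] k])
    have h\<phi>: "h H (\<phi> u) = h G u" if "u \<in> verts G" for u
      unfolding \<phi>_def using hk bij_betw_apply[OF h[OF GH(1)] that] by simp
    have injG: "inj_on (h G) (verts G)" and injH: "inj_on (h H) (verts H)"
      using h GH bij_betw_imp_inj_on by blast+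
    have "{u, v} \<in> edges G \<longleftrightarrow> {\<phi> u, \<phi> v} \<in> edges H"
      if uv: "u \<in> verts G" "v \<in> verts G" for u v
    proof -
      have \<phi>uv: "\<phi> u \<in> verts H" "\<phi> v \<in> verts H"
        using bij uv bij_betw_apply by metis+
      have "{u, v} \<in> edges G \<longleftrightarrow> (h G u, h G v) \<in>
        {(i, j) |i j u v. u \<in> verts G \<and> v \<in> verts G \<and> {u, v} \<in> edges G \<and> i = h G u \<and> j = h G v}"
        using uv inj_onD[OF injG] by blast
      also have "\<dots> \<longleftrightarrow> (h H (\<phi> u), h H (\<phi> v)) \<in>
        {(i, j) |i j u v. u \<in> verts H \<and> v \<in> verts H \<and> {u, v} \<in> edges H \<and> i = h H u \<and> j = h H v}"
        by (simp only: e h\<phi> uv)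
      also have "\<dots> \<longleftrightarrow> {\<phi> u, \<phi> v} \<in> edges H"
        using \<phi>uv inj_onD[OF injH] by blast
      finally show ?thesis .
    qed
    then have "isomorphic G H"
      unfolding isomorphic_def using bij by blast
    then show False using noniso GH by blast
  qed
  ultimately have "finite F"
    by (metis finite_SigmaI finite_atMost finite_Pow_iff finite_lessThan finite_subset inj_on_finite)
  then show False using inf by blast
qed

text \<open>Choosing one graph for each order that occurs gives an infinite family, nonisomorphic
  because the orders differ.\<close>

lemma recurrent_max_codesI:
  assumes "\<And>M. \<exists>G :: nat graph. simple_graph G \<and> regular d G \<and> max_code G = q \<and> card (verts G) \<ge> M"
  shows "q \<in> recurrent_max_codes d"
proof -
  define ok where "ok G \<longleftrightarrow> simple_graph G \<and> regular d G \<and> max_code G = q" for G :: "nat graph"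
  define sizes where "sizes = {card (verts G) |G. ok G}"
  have "infinite sizes"
  proof
    assume "finite sizes"
    then obtain M where M: "\<forall>n\<in>sizes. n < M"
      unfolding finite_nat_set_iff_bounded by blast
    obtain G :: "nat graph" where G: "ok G" "card (verts G) \<ge> M"
      unfolding ok_def using assms[of M] by blast
    then have "card (verts G) \<in> sizes"
      unfolding sizes_def by blast
    with M G(2) show False by fastforce
  qed
  have "\<forall>n\<in>sizes. \<exists>G. ok G \<and> card (verts G) = n"
    by (auto simp: sizes_def)
  then obtain g where g: "\<And>n. n \<in> sizes \<Longrightarrow> ok (g n) \<and> card (verts (g n)) = n"
    by metis
  have "inj_on g sizes"
    by (rule inj_onI) (metis g)
  then have "infinite (g ` sizes)"
    using \<open>infinite sizes\<close> finite_imageD by blast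
  moreover have "\<not> isomorphic G H" if "G \<in> g ` sizes" "H \<in> g ` sizes" "G \<noteq> H" for G H
    using that g by (metis bij_betw_same_card imageE isomorphic_def)
  ultimately show ?thesis
    unfolding recurrent_max_codes_def mem_Collect_eq using g
    by (intro exI[of _ "g ` sizes"]) (simp add: ok_def)
qed

lemma recurrent_max_codesE:
  assumes "q \<in> recurrent_max_codes d"
  obtains G :: "nat graph"
  where "simple_graph G" "regular d G" "max_code G = q" "card (verts G) > n"
proof -
  obtain F :: "nat graph set" where F: "infinite F"
    "\<And>G. G \<in> F \<Longrightarrow> simple_graph G \<and> regular d G \<and> max_code G = q"
    "\<And>G H. G \<in> F \<Longrightarrow> H \<in> F \<Longrightarrow> G \<noteq> H \<Longrightarrow> \<not> isomorphic G H"
    using assms unfolding recurrent_max_codes_def mem_Collect_eq by metis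
  then have "\<exists>G\<in>F. card (verts G) > n"
    using infinite_nonisomorphic_card_gt[of F n] by blast
  then show thesis
    using F(2) that by blast
qed

section \<open>Periodic graphs\<close>

definition arc :: "nat \<Rightarrow> nat \<times> nat \<Rightarrow> nat set" where
  "arc n = (\<lambda>(x, s). {x, (x + s) mod n})"

text \<open>Which of the steps 1 and 3 leave \<open>x\<close> depends on \<open>x mod 4\<close> only.\<close>

definition arcs :: "nat \<Rightarrow> (nat \<Rightarrow> nat set) \<Rightarrow> (nat \<times> nat) set" where
  "arcs N T = {(x, s). x < 4 * N \<and> s \<in> {1, 3} \<and> s \<in> T (x mod 4)}"

definition shift_edges :: "nat \<Rightarrow> (nat \<Rightarrow> nat set) \<Rightarrow> nat set set" where
  "shift_edges N T = arc (4 * N) ` arcs N T"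

definition shift_graph :: "nat \<Rightarrow> (nat \<Rightarrow> nat set) \<Rightarrow> nat graph" where
  "shift_graph N T = ({..<4 * N}, shift_edges N T)"

lemma mod_add_cases:
  fixes x s n :: nat
  assumes "x < n" "s \<le> n"
  shows "(x + s) mod n = (if x + s < n then x + s else x + s - n)"
  using assms by (simp add: mod_if)

lemma Suc_mod_cases:
  fixes x n :: nat
  assumes "x < n"
  shows "Suc x mod n = (if Suc x < n then Suc x else Suc x - n)"
  using assms by (simp add: mod_if)

text \<open>An edge read from both of its ends would require two steps with sum divisible by
  \<open>n\<close>, but this sum is at most 6.\<close>

lemma inj_on_arc:
  assumes "n \<ge> 8"
  shows "inj_on (arc n) ({..<n} \<times> {1, 3})"
  using assms
  by (intro inj_onI) (auto simp: arc_def mod_add_cases Suc_mod_cases doubleton_eq_iff split: if_splits)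

lemma arcs_subset: "arcs N T \<subseteq> {..<4 * N} \<times> {1, 3}"
  by (auto simp: arcs_def)

lemma simple_shift_graph:
  assumes "N \<ge> 2"
  shows "simple_graph (shift_graph N T)"
proof -
  have "arc (4 * N) p \<subseteq> {..<4 * N} \<and> card (arc (4 * N) p) = 2" if p: "p \<in> arcs N T" for p
  proof -
    obtain x s where p': "p = (x, s)" "x < 4 * N" "s = 1 \<or> s = 3"
      using p by (auto simp: arcs_def)
    then have "(x + s) mod (4 * N) \<noteq> x"
      using assms by (auto simp: mod_add_cases Suc_mod_cases split: if_splits)
    then show ?thesis
      using p'(1,2) assms by (simp add: arc_def)
  qed
  then show ?thesis
    by (auto simp: simple_graph_def shift_graph_def shift_edges_def)
qed

text \<open>Since \<open>arc\<close> is injective, symmetric differences may be computed on the step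
  sets, separately for each residue.\<close>

lemma sym_diff_shift_edges:
  assumes "N \<ge> 2"
  shows "sym_diff (shift_edges N S) (shift_edges N T) = shift_edges N (\<lambda>r. sym_diff (S r) (T r))"
proof -
  have inj: "inj_on (arc (4 * N)) ({..<4 * N} \<times> {1, 3})"
    using assms by (intro inj_on_arc) simp
  have "arc (4 * N) ` (arcs N P - arcs N Q) = shift_edges N P - shift_edges N Q" for P Q
    unfolding shift_edges_def
    by (rule inj_on_image_set_diff[OF inj]) (use arcs_subset in blast)+
  then have "sym_diff (shift_edges N S) (shift_edges N T)
      = arc (4 * N) ` sym_diff (arcs N S) (arcs N T)"
    by (simp add: image_Un)
  also have "sym_diff (arcs N S) (arcs N T) = arcs N (\<lambda>r. sym_diff (S r) (T r))"
    by (auto simp: arcs_def)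
  finally show ?thesis by (simp add: shift_edges_def)
qed

lemma shift_edges_mono:
  "(\<And>r. S r \<subseteq> T r) \<Longrightarrow> shift_edges N S \<subseteq> shift_edges N T"
  by (fastforce simp: shift_edges_def arcs_def)

lemma degree_shift_graph:
  assumes N: "N \<ge> 2" and v: "v < 4 * N"
  shows "degree (shift_graph N T) v =
    card ({1, 3} \<inter> T (v mod 4)) + card {s \<in> {1, 3}. s \<in> T ((v + 4 * N - s) mod 4)}"
proof -
  \<comment> \<open>This is the arc of step \<open>s\<close> that ends at \<open>v\<close>; adding
    \<open>4 * N\<close> keeps the natural subtraction from truncating.\<close>
  define prv where "prv s = ((v + 4 * N - s) mod (4 * N), s)" for s
  define out where "out = Pair v ` ({1, 3} \<inter> T (v mod 4))"
  define inc where "inc = prv ` {s \<in> {1, 3}. s \<in> T ((v + 4 * N - s) mod 4)}"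
  have inj: "inj_on (arc (4 * N)) ({..<4 * N} \<times> {1, 3})"
    using N by (intro inj_on_arc) simp
  have pred_eq: "(x + s) mod (4 * N) = v \<longleftrightarrow> x = (v + 4 * N - s) mod (4 * N)"
    if "x < 4 * N" "s \<in> {1, 3}" for x s
  proof -
    have s: "s \<le> 3" using that by auto
    then have "(v + 4 * N - s) mod (4 * N) = (if s \<le> v then v - s else v + 4 * N - s)"
      using v N by (auto simp: mod_if)
    moreover have "(x + s) mod (4 * N) = (if x + s < 4 * N then x + s else x + s - 4 * N)"
      using that N s by (intro mod_add_cases) auto
    ultimately show ?thesis
      using that(1) s v N by auto
  qed
  have mod4: "(v + 4 * N - s) mod (4 * N) mod 4 = (v + 4 * N - s) mod 4" for s
    by (simp add: mod_mod_cancel)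
  have "{e \<in> edges (shift_graph N T). v \<in> e} = arc (4 * N) ` (out \<union> inc)"
  proof -
    have "{p \<in> arcs N T. v \<in> arc (4 * N) p} = out \<union> inc"
    proof (intro set_eqI)
      fix p :: "nat \<times> nat"
      obtain x s where p: "p = (x, s)" by fastforce
      show "p \<in> {p \<in> arcs N T. v \<in> arc (4 * N) p} \<longleftrightarrow> p \<in> out \<union> inc"
      proof (cases "x < 4 * N \<and> s \<in> {1, 3}")
        case True
        then have "v \<in> arc (4 * N) p \<longleftrightarrow> x = v \<or> x = (v + 4 * N - s) mod (4 * N)"
          using pred_eq[of x s] unfolding p arc_def prod.case insert_iff empty_iff by metis
        then show ?thesis
          using True mod4[of s] by (auto simp: p out_def inc_def prv_def arcs_def)
      next
        case False
        then show ?thesis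
          using v N by (auto simp: p out_def inc_def prv_def arcs_def)
      qed
    qed
    then show ?thesis
      by (auto simp: shift_graph_def shift_edges_def)
  qed
  moreover have "out \<union> inc \<subseteq> {..<4 * N} \<times> {1, 3}"
    using v N by (auto simp: out_def inc_def prv_def)
  ultimately have "degree (shift_graph N T) v = card (out \<union> inc)"
    unfolding degree_def by (simp add: card_image inj_on_subset[OF inj])
  also have "\<dots> = card out + card inc"
  proof (rule card_Un_disjoint)
    show "out \<inter> inc = {}"
    proof -
      have "(v + s) mod (4 * N) \<noteq> v" if "s = 1 \<or> s = 3" for s
        using v N that by (auto simp: mod_add_cases Suc_mod_cases split: if_splits)
      then have "(v + 4 * N - s) mod (4 * N) \<noteq> v" if "s = 1 \<or> s = 3" for s
        using pred_eq[OF v, of s] that by (metis insertCI)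
      then show ?thesis
        by (fastforce simp: out_def inc_def prv_def)
    qed
  qed (auto simp: out_def inc_def)
  also have "card out = card ({1, 3} \<inter> T (v mod 4))"
    unfolding out_def by (intro card_image) (auto simp: inj_on_def)
  also have "card inc = card {s \<in> {1, 3}. s \<in> T ((v + 4 * N - s) mod 4)}"
    unfolding inc_def by (intro card_image) (auto simp: inj_on_def prv_def)
  finally show ?thesis .
qed

text \<open>Connectedness is tested on the integers, where no wraparound occurs: it suffices that
  every predicate constant along the selected steps is constant on consecutive integers.\<close>

lemma connected_shift_edges:
  assumes N: "N \<ge> 1" and ST: "\<And>r. S r \<subseteq> T r"
    and step: "\<And>k :: int \<Rightarrow> bool. (\<And>x s. s \<in> {1, 3} \<Longrightarrow> s \<in> S (nat (x mod 4)) \<Longrightarrow> k x = k (x + int s))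
      \<Longrightarrow> (\<And>x. k x = k (x + 1))"
  shows "connected_spanning (shift_graph N T) (shift_edges N S)"
proof -
  have "(u, v) \<in> (adj (shift_edges N S))\<^sup>*" if uv: "u < 4 * N" "v < 4 * N" for u v
  proof -
    \<comment> \<open>Reachability from \<open>u\<close>, extended periodically to all
      integers.\<close>
    define k where "k x \<longleftrightarrow> (u, nat (x mod (4 * int N))) \<in> (adj (shift_edges N S))\<^sup>*" for x
    have "k x = k (x + int s)" if s: "s \<in> {1, 3}" "s \<in> S (nat (x mod 4))" for x s
    proof -
      define y where "y = nat (x mod (4 * int N))"
      have y: "y < 4 * N" "int y = x mod (4 * int N)"
        using N by (auto simp: y_def nat_less_iff)
      have "int (y mod 4) = x mod 4"
        by (simp add: of_nat_mod y(2) mod_mod_cancel)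
      then have "y mod 4 = nat (x mod 4)" by linarith
      moreover have "nat ((x + int s) mod (4 * int N)) = (y + s) mod (4 * N)"
        using y(2) by (metis mod_add_left_eq nat_int of_nat_add of_nat_mod of_nat_mult of_nat_numeral)
      ultimately have "{y, nat ((x + int s) mod (4 * int N))} \<in> shift_edges N S"
        unfolding shift_edges_def using s y(1)
        by (intro image_eqI[of _ _ "(y, s)"]) (auto simp: arc_def arcs_def)
      then have "(y, nat ((x + int s) mod (4 * int N))) \<in> (adj (shift_edges N S))\<^sup>*"
        by (auto simp: adj_def)
      then show ?thesis
        unfolding k_def y_def[symmetric]
        by (meson rtrancl_trans sym_rtrancl_adj symD)
    qed
    then have k: "k x = k (x + 1)" for x
      by (rule step)
    have "k (int w) = k 0" for w
    proof (induction w)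
      case (Suc w)
      have "int (Suc w) = int w + 1" by simp
      then show ?case using Suc k[of "int w"] by (simp only:)
    qed simp
    then have "k (int u) = k (int v)" by simp
    moreover have "k (int u)"
      using uv by (simp add: k_def)
    ultimately show ?thesis
      using uv by (simp add: k_def)
  qed
  then show ?thesis
    using shift_edges_mono[OF ST] by (auto simp: connected_spanning_adj shift_graph_def)
qed

lemma int_chain_mod_4:
  fixes k :: "int \<Rightarrow> bool"
  assumes chain: "\<And>i. k (4 * i) = k (4 * i + 1) \<and> k (4 * i + 1) = k (4 * i + 2) \<and>
    k (4 * i + 2) = k (4 * i + 3) \<and> k (4 * i + 3) = k (4 * (i + 1))"
  shows "k x = k (x + 1)"
proof -
  define i where "i = x div 4"
  have "x = 4 * i \<or> x = 4 * i + 1 \<or> x = 4 * i + 2 \<or> x = 4 * i + 3"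
    unfolding i_def by presburger
  moreover have "4 * i + 1 + 1 = 4 * i + 2" "4 * i + 2 + 1 = 4 * i + 3" "4 * i + 3 + 1 = 4 * (i + 1)"
    by simp_all
  ultimately show ?thesis
    using chain[of i] by metis
qed

text \<open>With two distinct vertices the empty edge set is not connected, so different indices
  give different words.\<close>

lemma connectivity_code_image:
  assumes uv: "u \<in> verts G" "v \<in> verts G" "u \<noteq> v"
    and con: "\<And>w w'. w \<in> W \<Longrightarrow> w' \<in> W \<Longrightarrow> w \<noteq> w' \<Longrightarrow> connected_spanning G (sym_diff (A w) (A w'))"
    and sub: "\<And>w. w \<in> W \<Longrightarrow> A w \<subseteq> edges G"
  shows "connectivity_code G (A ` W)" and "card (A ` W) = card W"
proof -
  show "connectivity_code G (A ` W)"
    unfolding connectivity_code_def using con sub by blast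
  have "\<not> connected_spanning G {}"
    using uv by (auto simp: connected_spanning_def)
  then have "inj_on A W"
    using con by (intro inj_onI) (metis Diff_cancel sup_bot.right_neutral)
  then show "card (A ` W) = card W"
    by (rule card_image)
qed

lemma card_verts_shift_graph [simp]: "card (verts (shift_graph N T)) = 4 * N"
  by (simp add: shift_graph_def)

lemma edges_shift_graph: "edges (shift_graph N T) = shift_edges N T"
  by (simp add: shift_graph_def)

lemma shift_graph_code:
  assumes N: "N \<ge> 2" and sub: "\<And>w r. w \<in> W \<Longrightarrow> S w r \<subseteq> T r"
    and con: "\<And>w w'. w \<in> W \<Longrightarrow> w' \<in> W \<Longrightarrow> w \<noteq> w' \<Longrightarrow>
      connected_spanning (shift_graph N T) (shift_edges N (\<lambda>r. sym_diff (S w r) (S w' r)))"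
  shows "card W \<le> max_code (shift_graph N T)"
proof -
  have uv: "0 \<in> verts (shift_graph N T)" "1 \<in> verts (shift_graph N T)" "0 \<noteq> (1 :: nat)"
    using N by (auto simp: shift_graph_def)
  have sub': "shift_edges N (S w) \<subseteq> edges (shift_graph N T)" if "w \<in> W" for w
    unfolding edges_shift_graph using sub[OF that] by (rule shift_edges_mono)
  have con': "connected_spanning (shift_graph N T) (sym_diff (shift_edges N (S w)) (shift_edges N (S w')))"
    if "w \<in> W" "w' \<in> W" "w \<noteq> w'" for w w'
    using con[OF that] by (simp only: sym_diff_shift_edges[OF N])
  note code = connectivity_code_image[OF uv, of W "\<lambda>w. shift_edges N (S w)", OF con' sub']
  show ?thesis
    using max_code_ge[OF simple_shift_graph[OF N] code(1)] code(2) by simp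
qed

section \<open>The cycle: a code of size 2\<close>

definition cycle_steps :: "nat \<Rightarrow> nat set" where
  "cycle_steps r = {1}"

lemma regular_cycle:
  assumes "N \<ge> 2"
  shows "regular 2 (shift_graph N cycle_steps)"
proof -
  have "{s \<in> {1, 3}. s \<in> cycle_steps ((v + 4 * N - s) mod 4)} = {1}" for v
    by (auto simp: cycle_steps_def)
  then show ?thesis
    using degree_shift_graph[OF assms, of _ cycle_steps]
    by (simp add: regular_def) (simp add: shift_graph_def cycle_steps_def)
qed

lemma max_code_cycle:
  assumes N: "N \<ge> 2"
  shows "max_code (shift_graph N cycle_steps) = 2"
proof -
  have "card (UNIV :: bool set) \<le> max_code (shift_graph N cycle_steps)"
  \<comment> \<open>The two words are the empty set and the whole cycle.\<close>
  proof (rule shift_graph_code[OF N, where S = "\<lambda>w r. if w then {1} else {}"])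
    fix w w' :: bool assume "w \<noteq> w'"
    then show "connected_spanning (shift_graph N cycle_steps)
      (shift_edges N (\<lambda>r. sym_diff (if w then {1} else {}) (if w' then {1} else {})))"
      using N by (intro connected_shift_edges) (auto simp: cycle_steps_def)
  qed (auto simp: cycle_steps_def)
  moreover have "max_code (shift_graph N cycle_steps) \<le> 2"
    using N by (intro max_code_le_two simple_shift_graph regular_cycle) auto
  ultimately show ?thesis by simp
qed

section \<open>The cycle with chords: a code of size 4\<close>

definition cubic_steps :: "nat \<Rightarrow> nat set" where
  "cubic_steps r = (if even r then {1, 3} else {1})"

lemma regular_cubic:
  assumes N: "N \<ge> 2"
  shows "regular 3 (shift_graph N cubic_steps)"
proof -
  have "degree (shift_graph N cubic_steps) v = 3" if v: "v < 4 * N" for v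
  proof -
    \<comment> \<open>Both steps are odd, so an arc ending at \<open>v\<close> starts at the
      opposite parity. Thus each even vertex starts one chord and each odd vertex ends one.\<close>
    have par: "even ((v + 4 * N - s) mod 4) \<longleftrightarrow> odd v" if "s \<in> {1, 3}" for s
    proof -
      have "even ((v + 4 * N - s) mod 4) \<longleftrightarrow> even (v + 4 * N - s)"
        by (simp add: dvd_mod_iff)
      then show ?thesis using that N by auto
    qed
    show ?thesis
    proof (cases "even v")
      case True
      then have "{s \<in> {1, 3}. s \<in> cubic_steps ((v + 4 * N - s) mod 4)} = {1}"
        using par by (auto simp: cubic_steps_def)
      moreover have "even (v mod 4)" using True by (simp add: dvd_mod_iff)
      ultimately show ?thesis
        using degree_shift_graph[OF N v, of cubic_steps] by (simp add: cubic_steps_def)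
    next
      case False
      then have "{s \<in> {1, 3}. s \<in> cubic_steps ((v + 4 * N - s) mod 4)} = {1, 3}"
        using par by (auto simp: cubic_steps_def)
      moreover have "odd (v mod 4)" using False by (simp add: dvd_mod_iff)
      ultimately show ?thesis
        using degree_shift_graph[OF N v, of cubic_steps] by (simp add: cubic_steps_def)
    qed
  qed
  then show ?thesis
    by (simp add: regular_def) (simp add: shift_graph_def)
qed

text \<open>The cycle edges are split into two classes and the chords form a third one; every two of
  the three classes together form a connected spanning subgraph.\<close>

definition cubic_word :: "bool \<times> bool \<Rightarrow> nat \<Rightarrow> nat set" where
  "cubic_word w r = (if (if r < 2 then fst w else snd w) then {1} else {}) \<union>
     (if even r \<and> fst w \<noteq> snd w then {3} else {})"

lemma cubic_word_subset: "cubic_word w r \<subseteq> cubic_steps r"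
  by (simp add: cubic_word_def cubic_steps_def)

text \<open>Here \<open>fj i\<close> stands for \<open>k (4 * i + j)\<close>, and \<open>p\<close>,
  \<open>q\<close> say which halves of the cycle edges are present. If both are, the cycle suffices;
  if only one is, the chords bridge the gaps, and the adjacent blocks \<open>i - 1\<close> and
  \<open>i + 1\<close> supply all equations needed.\<close>

lemma cubic_chain:
  fixes f0 f1 f2 f3 :: "int \<Rightarrow> bool"
  assumes f: "\<And>i. p \<Longrightarrow> f0 i = f1 i" "\<And>i. p \<Longrightarrow> f1 i = f2 i"
      "\<And>i. q \<Longrightarrow> f2 i = f3 i" "\<And>i. q \<Longrightarrow> f3 i = f0 (i + 1)"
      "\<And>i. p \<noteq> q \<Longrightarrow> f0 i = f3 i" "\<And>i. p \<noteq> q \<Longrightarrow> f2 i = f1 (i + 1)"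
    and d: "p \<or> q"
  shows "f0 i = f1 i \<and> f1 i = f2 i \<and> f2 i = f3 i \<and> f3 i = f0 (i + 1)"
  using d f[of i] f[of "i - 1", unfolded diff_add_cancel] f[of "i + 1"]
  by argo

lemma max_code_cubic:
  assumes N: "N \<ge> 3"
  shows "max_code (shift_graph N cubic_steps) = 4"
proof -
  have N': "N \<ge> 2" "N \<ge> 1" using N by simp_all
  have "card (UNIV :: (bool \<times> bool) set) \<le> max_code (shift_graph N cubic_steps)"
  proof (rule shift_graph_code[OF N'(1), where S = cubic_word])
    fix w w' :: "bool \<times> bool" assume "w \<noteq> w'"
    then have ne: "(fst w \<noteq> fst w') \<or> (snd w \<noteq> snd w')" by (simp add: prod_eq_iff)
    define p where "p \<longleftrightarrow> fst w \<noteq> fst w'"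
    define q where "q \<longleftrightarrow> snd w \<noteq> snd w'"
    \<comment> \<open>Chord membership is the sum of the two cycle coordinates, so the chords differ
      exactly if one of the two coordinates does.\<close>
    have step: "1 \<in> sym_diff (cubic_word w r) (cubic_word w' r) \<longleftrightarrow> (if r < 2 then p else q)"
      "3 \<in> sym_diff (cubic_word w r) (cubic_word w' r) \<longleftrightarrow> even r \<and> p \<noteq> q" for r
      by (auto simp: cubic_word_def p_def q_def)
    show "connected_spanning (shift_graph N cubic_steps)
      (shift_edges N (\<lambda>r. sym_diff (cubic_word w r) (cubic_word w' r)))"
    proof (rule connected_shift_edges[OF N'(2)])
      fix k :: "int \<Rightarrow> bool"
      assume k: "\<And>x s. s \<in> {1, 3} \<Longrightarrow>
        s \<in> sym_diff (cubic_word w (nat (x mod 4))) (cubic_word w' (nat (x mod 4))) \<Longrightarrow>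
        k x = k (x + int s)"
      have k1: "k x = k (x + 1)" if "nat (x mod 4) = r" "if r < 2 then p else q" for x r
        using k[of 1 x] that step(1)[of r] by simp
      have k3: "k x = k (x + 3)" if "nat (x mod 4) = r" "even r" "p \<noteq> q" for x r
        using k[of 3 x] that step(2)[of r] by simp
      have "k (4 * i) = k (4 * i + 1) \<and> k (4 * i + 1) = k (4 * i + 2) \<and>
        k (4 * i + 2) = k (4 * i + 3) \<and> k (4 * i + 3) = k (4 * (i + 1))" for i
      proof (rule cubic_chain[of p _ _ _ q])
        show "p \<or> q" using ne by (simp add: p_def q_def)
        show "p \<Longrightarrow> k (4 * i) = k (4 * i + 1)" for i using k1[of "4 * i" 0] by (simp add: algebra_simps)
        show "p \<Longrightarrow> k (4 * i + 1) = k (4 * i + 2)" for i using k1[of "4 * i + 1" 1] by (simp add: algebra_simps)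
        show "q \<Longrightarrow> k (4 * i + 2) = k (4 * i + 3)" for i using k1[of "4 * i + 2" 2] by (simp add: algebra_simps)
        show "q \<Longrightarrow> k (4 * i + 3) = k (4 * (i + 1))" for i using k1[of "4 * i + 3" 3] by (simp add: algebra_simps)
        show "p \<noteq> q \<Longrightarrow> k (4 * i) = k (4 * i + 3)" for i using k3[of "4 * i" 0] by (simp add: algebra_simps)
        show "p \<noteq> q \<Longrightarrow> k (4 * i + 2) = k (4 * (i + 1) + 1)" for i using k3[of "4 * i + 2" 2] by (simp add: algebra_simps)
      qed
      then show "k x = k (x + 1)" for x by (rule int_chain_mod_4)
    next
      show "sym_diff (cubic_word w r) (cubic_word w' r) \<subseteq> cubic_steps r" for r
        using cubic_word_subset by blast
    qed
  qed (rule cubic_word_subset)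
  moreover have "max_code (shift_graph N cubic_steps) \<le> 4"
    using N by (intro max_code_le_four simple_shift_graph regular_cubic) auto
  ultimately show ?thesis by (simp add: card_UNIV_bool flip: UNIV_Times_UNIV)
qed

section \<open>The circulant graph with steps 1 and 3: a code of size 16\<close>

definition quartic_steps :: "nat \<Rightarrow> nat set" where
  "quartic_steps r = {1, 3}"

lemma regular_quartic:
  assumes "N \<ge> 2"
  shows "regular 4 (shift_graph N quartic_steps)"
proof -
  have "{s \<in> {1, 3}. s \<in> quartic_steps ((v + 4 * N - s) mod 4)} = {1, 3}" for v
    by (auto simp: quartic_steps_def)
  then show ?thesis
    using degree_shift_graph[OF assms, of _ quartic_steps]
    by (simp add: regular_def) (simp add: shift_graph_def quartic_steps_def)
qed

text \<open>The edge \<open>{x, x + 1}\<close> with \<open>x mod 4 = r\<close> is labelled by the basis vector \<open>e\<^sub>r\<close> of \<open>F\<^sub>2\<^sup>4\<close>, the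
  edge \<open>{x, x + 3}\<close> by the sum of the other three basis vectors, and a word consists of the edges on whose
  labels a linear functional is 1. These eight labels form an affine hyperplane, so 14 of the 15 nonzero
  functionals select exactly four of the eight edge classes, the least number that can connect.\<close>

definition parity4 :: "nat set \<Rightarrow> bool" where
  "parity4 S \<longleftrightarrow> (((0 \<in> S) \<noteq> (1 \<in> S)) \<noteq> (2 \<in> S)) \<noteq> (3 \<in> S)"

definition quartic_word :: "nat set \<Rightarrow> nat \<Rightarrow> nat set" where
  "quartic_word S r = (if r \<in> S then {1} else {}) \<union> (if (r \<in> S) \<noteq> parity4 S then {3} else {})"

lemma quartic_word_subset: "quartic_word S r \<subseteq> quartic_steps r"
  by (simp add: quartic_word_def quartic_steps_def)

text \<open>Again \<open>fj i\<close> stands for \<open>k (4 * i + j)\<close>; the cases are the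
  nonzero choices of \<open>d0\<close>, ..., \<open>d3\<close>. Block \<open>i + 1 + 1\<close> is
  included because, if only \<open>d0\<close> holds, \<open>f3 i\<close> is linked to
  \<open>f2 (i + 1)\<close> and from there to \<open>f1 (i + 1 + 1)\<close>.\<close>

lemma quartic_chain:
  fixes f0 f1 f2 f3 :: "int \<Rightarrow> bool"
  assumes f: "\<And>i. d0 \<Longrightarrow> f0 i = f1 i" "\<And>i. d1 \<Longrightarrow> f1 i = f2 i"
      "\<And>i. d2 \<Longrightarrow> f2 i = f3 i" "\<And>i. d3 \<Longrightarrow> f3 i = f0 (i + 1)"
      "\<And>i. d0 \<noteq> c \<Longrightarrow> f0 i = f3 i" "\<And>i. d1 \<noteq> c \<Longrightarrow> f1 i = f0 (i + 1)"
      "\<And>i. d2 \<noteq> c \<Longrightarrow> f2 i = f1 (i + 1)" "\<And>i. d3 \<noteq> c \<Longrightarrow> f3 i = f2 (i + 1)"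
    and c: "c = (((d0 \<noteq> d1) \<noteq> d2) \<noteq> d3)" and d: "d0 \<or> d1 \<or> d2 \<or> d3"
  shows "f0 i = f1 i \<and> f1 i = f2 i \<and> f2 i = f3 i \<and> f3 i = f0 (i + 1)"
  using d c f[of i] f[of "i - 1", unfolded diff_add_cancel] f[of "i + 1"] f[of "i + 1 + 1"]
  by argo

lemma connected_quartic:
  assumes N: "N \<ge> 2" and ST: "S \<subseteq> {..<4}" "T \<subseteq> {..<4}" "S \<noteq> T"
  shows "connected_spanning (shift_graph N quartic_steps)
    (sym_diff (shift_edges N (quartic_word S)) (shift_edges N (quartic_word T)))"
proof -
  define d where "d r \<longleftrightarrow> (r \<in> S) \<noteq> (r \<in> T)" for r
  \<comment> \<open>\<open>parity4\<close> is additive over symmetric differences, so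
    \<open>c\<close> tells whether the parities of \<open>S\<close> and \<open>T\<close>
    differ.\<close>
  define c where "c \<longleftrightarrow> ((d 0 \<noteq> d 1) \<noteq> d 2) \<noteq> d 3"
  have step: "1 \<in> sym_diff (quartic_word S r) (quartic_word T r) \<longleftrightarrow> d r"
    "3 \<in> sym_diff (quartic_word S r) (quartic_word T r) \<longleftrightarrow> d r \<noteq> c" for r
    by (auto simp: quartic_word_def parity4_def c_def d_def)
  obtain t where "d t" "t < 4"
    using ST by (auto simp: d_def)
  then have "t = 0 \<or> t = 1 \<or> t = 2 \<or> t = 3" by linarith
  with \<open>d t\<close> have d: "d 0 \<or> d 1 \<or> d 2 \<or> d 3" by metis
  show ?thesis
    unfolding sym_diff_shift_edges[OF N]
  proof (rule connected_shift_edges)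
    fix k :: "int \<Rightarrow> bool"
    assume k: "\<And>x s. s \<in> {1, 3} \<Longrightarrow>
      s \<in> sym_diff (quartic_word S (nat (x mod 4))) (quartic_word T (nat (x mod 4))) \<Longrightarrow>
      k x = k (x + int s)"
    have k1: "k x = k (x + 1)" if "nat (x mod 4) = r" "d r" for x r
      using k[of 1 x] that step(1)[of r] by simp
    have k3: "k x = k (x + 3)" if "nat (x mod 4) = r" "d r \<noteq> c" for x r
      using k[of 3 x] that step(2)[of r] by simp
    have "k (4 * i) = k (4 * i + 1) \<and> k (4 * i + 1) = k (4 * i + 2) \<and>
      k (4 * i + 2) = k (4 * i + 3) \<and> k (4 * i + 3) = k (4 * (i + 1))" for i
    proof (rule quartic_chain[OF _ _ _ _ _ _ _ _ c_def d])
      show "d 0 \<Longrightarrow> k (4 * i) = k (4 * i + 1)" for i using k1[of "4 * i" 0] by (simp add: algebra_simps)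
      show "d 1 \<Longrightarrow> k (4 * i + 1) = k (4 * i + 2)" for i using k1[of "4 * i + 1" 1] by (simp add: algebra_simps)
      show "d 2 \<Longrightarrow> k (4 * i + 2) = k (4 * i + 3)" for i using k1[of "4 * i + 2" 2] by (simp add: algebra_simps)
      show "d 3 \<Longrightarrow> k (4 * i + 3) = k (4 * (i + 1))" for i using k1[of "4 * i + 3" 3] by (simp add: algebra_simps)
      show "d 0 \<noteq> c \<Longrightarrow> k (4 * i) = k (4 * i + 3)" for i using k3[of "4 * i" 0] by (simp add: algebra_simps)
      show "d 1 \<noteq> c \<Longrightarrow> k (4 * i + 1) = k (4 * (i + 1))" for i using k3[of "4 * i + 1" 1] by (simp add: algebra_simps)
      show "d 2 \<noteq> c \<Longrightarrow> k (4 * i + 2) = k (4 * (i + 1) + 1)" for i using k3[of "4 * i + 2" 2] by (simp add: algebra_simps)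
      show "d 3 \<noteq> c \<Longrightarrow> k (4 * i + 3) = k (4 * (i + 1) + 2)" for i using k3[of "4 * i + 3" 3] by (simp add: algebra_simps)
    qed
    then show "k x = k (x + 1)" for x by (rule int_chain_mod_4)
  next
    show "sym_diff (quartic_word S r) (quartic_word T r) \<subseteq> quartic_steps r" for r
      using quartic_word_subset by blast
  qed (use N in simp)
qed

section \<open>From degree \<open>d\<close> to degree \<open>d + 1\<close>\<close>

text \<open>The code words \<open>A S\<close> are indexed by the subsets \<open>S\<close> of the \<open>d\<close>-element set \<open>I\<close>.\<close>

definition full_code :: "nat \<Rightarrow> nat \<Rightarrow> nat set set \<Rightarrow> (nat set \<Rightarrow> nat set set) \<Rightarrow> nat set \<Rightarrow> bool" where
  "full_code d n E A I \<longleftrightarrow> simple_graph ({..<n}, E) \<and> regular d ({..<n}, E) \<and> (\<forall>S. A S \<subseteq> E) \<and>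
     (\<forall>S\<subseteq>I. \<forall>T\<subseteq>I. S \<noteq> T \<longrightarrow> connected_spanning ({..<n}, E) (sym_diff (A S) (A T)))"

text \<open>Lets copy \<open>i\<close> of the later construction use \<open>{..d} - {i}\<close> as
  its index set.\<close>

lemma full_code_reindex:
  assumes "full_code d n E A J" and "bij_betw g I J"
  shows "full_code d n E (\<lambda>S. A (g ` S)) I"
proof -
  have "g ` S \<subseteq> J" if "S \<subseteq> I" for S
    using assms(2) that by (auto simp: bij_betw_def)
  moreover have "g ` S \<noteq> g ` T" if "S \<subseteq> I" "T \<subseteq> I" "S \<noteq> T" for S T
    using assms(2) that inj_on_image_eq_iff[of g I S T] by (simp add: bij_betw_def)
  ultimately show ?thesis
    using assms(1) by (simp add: full_code_def)
qed

lemma full_code_max_code: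
  assumes full: "full_code d n E A {..<d}" and "n \<ge> 2" "d > 0"
  shows "max_code ({..<n}, E) = 2 ^ d"
proof (rule antisym)
  have G: "simple_graph ({..<n}, E)" "regular d ({..<n}, E)"
    using full by (simp_all add: full_code_def)
  show "max_code ({..<n}, E) \<le> 2 ^ d"
    by (rule max_code_le_power[OF G \<open>d > 0\<close>])
  have uv: "0 \<in> verts ({..<n}, E)" "1 \<in> verts ({..<n}, E)" "0 \<noteq> (1 :: nat)"
    using \<open>n \<ge> 2\<close> by auto
  note code = connectivity_code_image[OF uv, of "Pow {..<d}" A]
  have "card (Pow {..<d}) \<le> max_code ({..<n}, E)"
    using max_code_ge[OF G(1) code(1)] code(2) full by (simp add: full_code_def)
  then show "2 ^ d \<le> max_code ({..<n}, E)"
    by (simp add: card_Pow)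
qed

section \<open>Three copies joined by matchings\<close>

definition emb :: "nat \<Rightarrow> nat \<Rightarrow> nat" where
  "emb i v = 3 * v + i"

text \<open>The residue modulo 3 recovers the copy and the quotient the vertex. Interleaving the
  copies keeps the vertex set an initial segment of the naturals.\<close>

lemma emb_eq_iff:
  assumes "i < 3" "j < 3"
  shows "emb i u = emb j v \<longleftrightarrow> i = j \<and> u = v"
proof
  assume eq: "emb i u = emb j v"
  have "emb i u mod 3 = i" "emb j v mod 3 = j"
    using assms by (simp_all add: emb_def)
  with eq show "i = j \<and> u = v"
    by (auto simp: emb_def)
qed simp

lemma inj_emb: "inj (emb i)"
  by (auto simp: inj_def emb_def)

lemma emb_cases:
  assumes "x < 3 * n"
  obtains i v where "i < 3" "v < n" "x = emb i v"
proof
  show "x mod 3 < 3" "x div 3 < n" "x = emb (x mod 3) (x div 3)"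
    using assms by (auto simp: emb_def)
qed

definition nxt :: "nat \<Rightarrow> nat" where
  "nxt i = (i + 1) mod 3"

text \<open>For \<open>k < h\<close> this joins the lower half of copy \<open>i\<close> to the upper
  half of the next copy, so each vertex of a copy with \<open>2 * h\<close> vertices lies on one
  cross edge.\<close>

definition cross :: "nat \<Rightarrow> nat \<Rightarrow> nat \<Rightarrow> nat set" where
  "cross h k i = {emb i k, emb (nxt i) (k + h)}"

text \<open>The linear form \<open>w\<^sub>i + w\<^sub>j\<close>, or \<open>w\<^sub>i + w\<^sub>j + w\<^sub>k\<close> if \<open>k\<close> differs from \<open>i\<close> and \<open>j\<close>,
  evaluated at the word \<open>w\<close> with support \<open>S\<close>. It has to contain \<open>w\<^sub>i\<close> and \<open>w\<^sub>j\<close> because all cross edges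
  at copy \<open>i\<close> have to change if words differ only in the coordinate \<open>i\<close>.\<close>

definition form :: "nat \<Rightarrow> nat \<Rightarrow> nat set \<Rightarrow> bool" where
  "form k i S \<longleftrightarrow> ((i \<in> S) \<noteq> (nxt i \<in> S)) \<noteq> (k \<in> S \<and> k \<noteq> i \<and> k \<noteq> nxt i)"

definition copies :: "(nat \<Rightarrow> nat set set) \<Rightarrow> nat set set" where
  "copies B = {emb i ` e |i e. i < 3 \<and> e \<in> B i}"

definition crosses :: "nat \<Rightarrow> (nat \<Rightarrow> nat \<Rightarrow> bool) \<Rightarrow> nat set set" where
  "crosses h P = {cross h k i |k i. k < h \<and> i < 3 \<and> P k i}"

lemma nxt_simps [simp]: "nxt 0 = 1" "nxt (Suc 0) = 2" "nxt 2 = 0"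
  by (simp_all add: nxt_def)

lemma nxt_less: "nxt i < 3"
  by (simp add: nxt_def)

lemma less_3_cases: "i < (3 :: nat) \<Longrightarrow> i = 0 \<or> i = 1 \<or> i = 2"
  by auto

lemma nxt_eqs: "i < 3 \<Longrightarrow> nxt i \<noteq> i \<and> nxt (nxt i) \<noteq> i \<and> nxt (nxt i) \<noteq> nxt i \<and> nxt (nxt (nxt i)) = i"
  by (auto dest!: less_3_cases)

lemma emb_image_in_copies:
  assumes "i < 3" "e \<noteq> {}" "\<And>j. {} \<notin> B j"
  shows "emb i ` e \<in> copies B \<longleftrightarrow> e \<in> B i"
proof
  assume "emb i ` e \<in> copies B"
  then obtain j e' where j: "j < 3" "e' \<in> B j" "emb i ` e = emb j ` e'"
    by (auto simp: copies_def)
  obtain u where "u \<in> e" using assms(2) by blast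
  then obtain u' where "u' \<in> e'" "emb i u = emb j u'"
    using j(3) by blast
  then have "i = j" using emb_eq_iff assms(1) j(1) by blast
  then show "e \<in> B i"
    using j inj_image_eq_iff[OF inj_emb] by metis
qed (use assms in \<open>auto simp: copies_def\<close>)

text \<open>The end in the lower half of its copy determines both \<open>k\<close> and
  \<open>i\<close>.\<close>

lemma cross_in_crosses:
  assumes "k < h" "i < 3"
  shows "cross h k i \<in> crosses h P \<longleftrightarrow> P k i"
proof
  assume "cross h k i \<in> crosses h P"
  then obtain k' i' where k': "k' < h" "i' < 3" "P k' i'" "cross h k i = cross h k' i'"
    by (auto simp: crosses_def)
  then have "emb i k = emb i' k' \<or> emb i k = emb (nxt i') (k' + h)"
    by (auto simp: cross_def doubleton_eq_iff)
  then have "i = i'" "k = k'"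
    using assms k'(1,2) nxt_less by (auto simp: emb_eq_iff)
  then show "P k i" using k' by simp
qed (use assms in \<open>auto simp: crosses_def\<close>)

lemma cross_not_in_copies: "i < 3 \<Longrightarrow> cross h k i \<notin> copies B"
proof
  assume i: "i < 3" "cross h k i \<in> copies B"
  then obtain j e where j: "j < 3" "cross h k i = emb j ` e"
    by (auto simp: copies_def)
  then have "emb i k \<in> emb j ` e" "emb (nxt i) (k + h) \<in> emb j ` e"
    by (auto simp: cross_def)
  then have "i = j" "nxt i = j"
    using i(1) j(1) nxt_less by (auto simp: emb_eq_iff)
  then show False using nxt_eqs[OF i(1)] by simp
qed

lemma emb_image_not_in_crosses: "i < 3 \<Longrightarrow> emb i ` e \<notin> crosses h P"
proof
  assume i: "i < 3" and "emb i ` e \<in> crosses h P"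
  then obtain k j where kj: "j < 3" "emb i ` e = cross h k j"
    by (auto simp: crosses_def)
  have "emb i ` e \<in> copies (\<lambda>_. {e})"
    using i by (auto simp: copies_def)
  then show False
    using cross_not_in_copies[OF kj(1)] kj(2) by simp
qed

lemma degree_three_copies:
  assumes G: "simple_graph ({..<2 * h}, E i)" and i: "i < 3" and v: "v < 2 * h"
  shows "degree ({..<3 * (2 * h)}, copies E \<union> crosses h (\<lambda>k i. True)) (emb i v) =
    degree ({..<2 * h}, E i) v + 1"
proof -
  \<comment> \<open>The only cross edge at \<open>emb i v\<close>: it leads to the next copy from
    the lower half and to the previous copy, \<open>nxt (nxt i)\<close>, from the upper
    half.\<close>
  define m where "m = (if v < h then cross h v i else cross h (v - h) (nxt (nxt i)))"
  have cop: "{e \<in> copies E. emb i v \<in> e} = (`) (emb i) ` {e \<in> E i. v \<in> e}"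
    using i by (auto simp: copies_def emb_eq_iff image_iff)
  have crs: "{e \<in> crosses h (\<lambda>k i. True). emb i v \<in> e} = {m}"
  proof -
    have *: "k < h \<and> j < 3 \<and> emb i v \<in> cross h k j \<longleftrightarrow>
      (if v < h then k = v \<and> j = i else k = v - h \<and> j = nxt (nxt i))" for k j
    proof (cases "j < 3")
      case True
      then have "emb i v \<in> cross h k j \<longleftrightarrow> i = j \<and> v = k \<or> i = nxt j \<and> v = k + h"
        using i nxt_less by (auto simp: cross_def emb_eq_iff)
      moreover have "i = nxt j \<longleftrightarrow> j = nxt (nxt i)"
        using nxt_eqs i True by metis
      ultimately show ?thesis
        using True i v by auto
    next
      case False
      then show ?thesis using i nxt_less[of "nxt i"] by auto
    qed
    then have "e \<in> crosses h (\<lambda>k i. True) \<and> emb i v \<in> e \<longleftrightarrow> e = m" for e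
    proof -
      have "e \<in> crosses h (\<lambda>k i. True) \<and> emb i v \<in> e \<longleftrightarrow>
        (\<exists>k j. e = cross h k j \<and> (k < h \<and> j < 3 \<and> emb i v \<in> cross h k j))"
        unfolding crosses_def by blast
      then show ?thesis
        using * by (simp add: m_def)
    qed
    then show ?thesis by blast
  qed
  have "{e \<in> copies E \<union> crosses h (\<lambda>k i. True). emb i v \<in> e}
      = {e \<in> copies E. emb i v \<in> e} \<union> {e \<in> crosses h (\<lambda>k i. True). emb i v \<in> e}"
    by auto
  then have "{e \<in> copies E \<union> crosses h (\<lambda>k i. True). emb i v \<in> e}
      = insert m ((`) (emb i) ` {e \<in> E i. v \<in> e})"
    unfolding cop crs by simp
  moreover have "m \<notin> (`) (emb i) ` {e \<in> E i. v \<in> e}"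
  proof
    assume "m \<in> (`) (emb i) ` {e \<in> E i. v \<in> e}"
    then have "m \<in> copies E" using i by (auto simp: copies_def)
    then show False
      using cross_not_in_copies[OF i] cross_not_in_copies[OF nxt_less[of "nxt i"]]
      by (auto simp: m_def split: if_splits)
  qed
  moreover have "finite {e \<in> E i. v \<in> e}"
    using finite_edges[OF G] by simp
  moreover have "card ((`) (emb i) ` {e \<in> E i. v \<in> e}) = card {e \<in> E i. v \<in> e}"
    by (intro card_image inj_onI) (metis inj_image_eq_iff inj_emb)
  ultimately show ?thesis
    by (simp add: degree_def)
qed

text \<open>At most one of the three pairs of copies is joined only by cross edges on which \<open>S\<close> and \<open>T\<close> agree.\<close>

lemma form_differs:
  assumes i: "i < 3" and d: "d \<ge> 2" and ST: "S \<subseteq> {..d}" "T \<subseteq> {..d}" "S \<noteq> T"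
    and none: "\<And>k. k \<le> d \<Longrightarrow> form k i S = form k i T"
  shows "(i \<in> S) \<noteq> (i \<in> T)" "(nxt i \<in> S) \<noteq> (nxt i \<in> T)" "(nxt (nxt i) \<in> S) = (nxt (nxt i) \<in> T)"
proof -
  define \<delta> where "\<delta> k \<longleftrightarrow> (k \<in> S) \<noteq> (k \<in> T)" for k
  have eq: "(\<delta> i \<noteq> \<delta> (nxt i)) = (\<delta> k \<and> k \<noteq> i \<and> k \<noteq> nxt i)" if "k \<le> d" for k
    using none[OF that] by (auto simp: form_def \<delta>_def)
  have "i \<le> d" "nxt i \<le> d" "nxt (nxt i) \<le> d"
    using i d nxt_less[of i] nxt_less[of "nxt i"] by auto
  \<comment> \<open>At \<open>k = i\<close> the third summand of the form is absent; once the first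
    two cancel, any other \<open>k\<close> shows that \<open>S\<close> and \<open>T\<close> agree at
    \<open>k\<close>.\<close>
  then have 1: "\<delta> i = \<delta> (nxt i)" using eq[of i] by simp
  then have rest: "\<not> \<delta> k" if "k \<noteq> i" "k \<noteq> nxt i" "k \<le> d" for k
    using eq[of k] that by simp
  obtain t where "\<delta> t" "t \<le> d"
    using ST by (auto simp: \<delta>_def)
  then have "\<delta> i" using rest[of t] 1 by metis
  then show "(i \<in> S) \<noteq> (i \<in> T)" "(nxt i \<in> S) \<noteq> (nxt i \<in> T)" "(nxt (nxt i) \<in> S) = (nxt (nxt i) \<in> T)"
    using 1 rest[of "nxt (nxt i)"] nxt_eqs[OF i] \<open>nxt (nxt i) \<le> d\<close> by (auto simp: \<delta>_def)
qed

text \<open>Copy \<open>i\<close> is connected internally unless \<open>S\<close> and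
  \<open>T\<close> differ only in \<open>i\<close>. In that exceptional case its vertices are
  attached singly by cross edges; otherwise \<open>form_differs\<close> yields two joined pairs of
  copies. The bound \<open>h > d\<close> ensures that every form with \<open>k \<le> d\<close>
  labels a cross edge.\<close>

lemma connected_three_copies:
  assumes d: "d \<ge> 2" and h: "h > d" and ST: "S \<subseteq> {..d}" "T \<subseteq> {..d}" "S \<noteq> T"
    and copy: "\<And>i u v. i < 3 \<Longrightarrow> S - {i} \<noteq> T - {i} \<Longrightarrow> u < 2 * h \<Longrightarrow> v < 2 * h \<Longrightarrow>
      (emb i u, emb i v) \<in> (adj R)\<^sup>*"
    and cross: "\<And>k i. i < 3 \<Longrightarrow> k < h \<Longrightarrow> form k i S \<noteq> form k i T \<Longrightarrow> cross h k i \<in> R"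
    and xy: "x < 3 * (2 * h)" "y < 3 * (2 * h)"
  shows "(x, y) \<in> (adj R)\<^sup>*"
proof -
  define conn where "conn x y \<longleftrightarrow> (x, y) \<in> (adj R)\<^sup>*" for x y
  have refl: "conn x x" for x
    by (simp add: conn_def)
  have sym: "conn x y \<Longrightarrow> conn y x" for x y
    unfolding conn_def by (meson sym_rtrancl_adj symD)
  have trans: "conn x y \<Longrightarrow> conn y z \<Longrightarrow> conn x z" for x y z
    unfolding conn_def by (rule rtrancl_trans)
  have cr: "conn (emb i k) (emb (nxt i) (k + h))" if "i < 3" "k < h" "form k i S \<noteq> form k i T" for i k
    using cross[OF that] by (auto simp: conn_def cross_def adj_def)
  have alive: "conn (emb i u) (emb i v)" if "i < 3" "S - {i} \<noteq> T - {i}" "u < 2 * h" "v < 2 * h" for i u v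
    using copy[OF that] by (simp add: conn_def)
  have join: "conn (emb i u) (emb (nxt i) v)"
    if "i < 3" "S - {i} \<noteq> T - {i}" "S - {nxt i} \<noteq> T - {nxt i}" "k < h" "form k i S \<noteq> form k i T"
      "u < 2 * h" "v < 2 * h" for i k u v
    using trans[OF alive[of i u k] trans[OF cr[of i k] alive[of "nxt i" "k + h" v]]] that nxt_less
    by simp
  have "\<exists>c. \<forall>i<3. \<forall>u<2 * h. conn (emb i u) c"
  proof (cases "\<exists>i<3. S - {i} = T - {i}")
    case True
    then obtain i where i: "i < 3" "S - {i} = T - {i}" by blast
    have eq: "k \<in> S \<longleftrightarrow> k \<in> T" if "k \<noteq> i" for k
      using i(2) that by blast
    have ne: "(i \<in> S) \<noteq> (i \<in> T)"
      using ST(3) eq by (metis subsetI subset_antisym)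
    note n = nxt_eqs[OF i(1)]
    define a b where "a = nxt i" and "b = nxt a"
    have ab: "a < 3" "b < 3" "a \<noteq> i" "b \<noteq> i" "a \<noteq> b" "nxt i = a" "nxt a = b" "nxt b = i"
      using n nxt_less by (auto simp: a_def b_def)
    have "S - {j} \<noteq> T - {j}" if "j \<noteq> i" for j
    proof
      assume "S - {j} = T - {j}"
      then have "i \<in> S - {j} \<longleftrightarrow> i \<in> T - {j}" by simp
      then show False using ne that by simp
    qed
    then have al: "S - {a} \<noteq> T - {a}" "S - {b} \<noteq> T - {b}"
      using ab by simp_all
    define c where "c = emb a 0"
    have ca: "conn (emb a u) c" if "u < 2 * h" for u
      unfolding c_def using alive[OF ab(1) al(1) that] h by simp
    \<comment> \<open>Choosing \<open>k = i\<close> brings the one differing coordinate into the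
      form between \<open>a\<close> and \<open>b\<close>, which joins the two internally connected
      copies.\<close>
    have fi: "form i a S \<noteq> form i a T"
      using ne eq[of a] eq[of b] ab by (auto simp: form_def)
    have cb: "conn (emb b u) c" if "u < 2 * h" for u
      unfolding c_def
      using sym[OF join[OF ab(1) al(1), of i 0 u]] al(2) ab(7) fi that h d i(1) by simp
    have fa: "form k i S \<noteq> form k i T" for k
      using ne eq[of k] eq[of a] ab by (auto simp: form_def)
    have fb: "form k b S \<noteq> form k b T" for k
      using ne eq[of k] eq[of b] ab by (auto simp: form_def)
    \<comment> \<open>All cross edges at copy \<open>i\<close> are present: its lower half hangs on
      copy \<open>a\<close>, its upper half on copy \<open>b\<close>.\<close>
    have ci: "conn (emb i u) c" if u: "u < 2 * h" for u
    proof (cases "u < h")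
      case True
      have "conn (emb i u) (emb a (u + h))"
        using cr[OF i(1) True fa] by (simp add: ab(6))
      then show ?thesis
        by (rule trans) (use True in \<open>simp add: ca\<close>)
    next
      case False
      then have "conn (emb b (u - h)) (emb i u)"
        using cr[OF ab(2) _ fb, of "u - h"] u by (simp add: ab(8))
      from sym[OF this] show ?thesis
        by (rule trans) (use u in \<open>simp add: cb\<close>)
    qed
    have "j = i \<or> j = a \<or> j = b" if "j < 3" for j
      using that ab(1-5) i(1) by (auto dest!: less_3_cases)
    then show ?thesis using ca cb ci by blast
  next
    case False
    then have al: "S - {i} \<noteq> T - {i}" if "i < 3" for i using that by blast
    \<comment> \<open>If some pair of copies has no differing form, \<open>i\<close> is the index of
      that pair; two such pairs would contradict each other on a shared coordinate. The other two
      pairs form a path through all copies.\<close>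
    obtain i where i: "i < 3" "\<exists>k\<le>d. form k (nxt i) S \<noteq> form k (nxt i) T"
      "\<exists>k\<le>d. form k (nxt (nxt i)) S \<noteq> form k (nxt (nxt i)) T"
    proof (cases "\<forall>i<3. \<exists>k\<le>d. form k i S \<noteq> form k i T")
      case True
      then show ?thesis using that[of 0] by simp
    next
      case False
      then obtain i where i: "i < 3" "\<And>k. k \<le> d \<Longrightarrow> form k i S = form k i T" by blast
      note f = form_differs[OF i(1) d ST i(2)]
      have "\<exists>k\<le>d. form k j S \<noteq> form k j T" if "j = nxt i \<or> j = nxt (nxt i)" for j
      proof (rule ccontr)
        assume "\<not> ?thesis"
        then have none: "\<And>k. k \<le> d \<Longrightarrow> form k j S = form k j T" by blast
        have "j < 3" using that nxt_less by auto
        note g = form_differs[OF this d ST none]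
        show False
          using that f g nxt_eqs[OF i(1)] by auto
      qed
      then show ?thesis using that[OF i(1)] by blast
    qed
    define a b where "a = nxt i" and "b = nxt a"
    have ab: "a < 3" "b < 3" "nxt a = b" "nxt b = i" "a \<noteq> i" "b \<noteq> i" "a \<noteq> b"
      using nxt_eqs[OF i(1)] nxt_less by (auto simp: a_def b_def)
    obtain k l where kl: "k \<le> d" "form k a S \<noteq> form k a T" "l \<le> d" "form l b S \<noteq> form l b T"
      using i(2,3) unfolding a_def b_def by blast
    define c where "c = emb b 0"
    have ca: "conn (emb a u) c" if "u < 2 * h" for u
      unfolding c_def using join[OF ab(1) al[OF ab(1)], of k u 0] al[OF ab(2)] ab(3) kl h that by simp
    have cb: "conn (emb b u) c" if "u < 2 * h" for u
      unfolding c_def using alive[OF ab(2) al[OF ab(2)] that] h by simp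
    have ci: "conn (emb i u) c" if "u < 2 * h" for u
      unfolding c_def using sym[OF join[OF ab(2) al[OF ab(2)], of l 0 u]] al[OF i(1)] ab(4) kl h that by simp
    have "j = i \<or> j = a \<or> j = b" if "j < 3" for j
      using that ab i(1) by (auto dest!: less_3_cases)
    then show ?thesis using ca cb ci by blast
  qed
  then obtain c where c: "\<And>i u. i < 3 \<Longrightarrow> u < 2 * h \<Longrightarrow> conn (emb i u) c" by blast
  have "conn z c" if "z < 3 * (2 * h)" for z
    using emb_cases[OF that] c by metis
  then have "conn x c" "conn y c"
    using xy by blast+
  then have "conn x y"
    using sym trans by blast
  then show ?thesis by (simp add: conn_def)
qed

lemma full_code_Suc:
  assumes full: "full_code d (2 * h) E A {..<d}" and d: "d \<ge> 2" and h: "h > d"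
  shows "\<exists>E' A'. full_code (Suc d) (3 * (2 * h)) E' A' {..<Suc d}"
proof -
  have G: "simple_graph ({..<2 * h}, E)" and reg: "regular d ({..<2 * h}, E)"
    using full by (simp_all add: full_code_def)
  have "\<exists>B. full_code d (2 * h) E B ({..d} - {i})" if "i < 3" for i
  proof -
    have "card ({..d} - {i}) = card {..<d}"
      using that d by (simp add: card_Diff_singleton_if)
    then obtain g where "bij_betw g ({..d} - {i}) {..<d}"
      using bij_betw_iff_card[of "{..d} - {i}" "{..<d}"] by auto
    then show ?thesis
      using full_code_reindex[OF full] by blast
  qed
  then obtain B where B: "\<And>i. i < 3 \<Longrightarrow> full_code d (2 * h) E (B i) ({..d} - {i})"
    by metis
  \<comment> \<open>The value \<open>{}\<close> for \<open>i \<ge> 3\<close> makes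
    \<open>word S i \<subseteq> E\<close> hold for every \<open>i\<close>.\<close>
  define word where "word S i = (if i < 3 then B i (S - {i}) else {})" for S i
  define E' where "E' = copies (\<lambda>_. E) \<union> crosses h (\<lambda>_ _. True)"
  define A' where "A' S = copies (word S) \<union> crosses h (\<lambda>k i. form k i S)" for S
  have ne: "{} \<notin> E"
    using G by (auto simp: simple_graph_def)
  have word: "word S i \<subseteq> E" for S i
    using B by (auto simp: word_def full_code_def)
  have sub: "A' S \<subseteq> E'" for S
    using word unfolding A'_def E'_def copies_def crosses_def by blast
  have simple: "simple_graph ({..<3 * (2 * h)}, E')"
  proof -
    have "e \<subseteq> {..<3 * (2 * h)} \<and> card e = 2" if e: "e \<in> E'" for e
    proof -
      from e consider i e0 where "i < 3" "e0 \<in> E" "e = emb i ` e0" | k i where "k < h" "i < 3" "e = cross h k i"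
        by (auto simp: E'_def copies_def crosses_def)
      then show ?thesis
      proof cases
        case 1
        then have "e0 \<subseteq> {..<2 * h}" "card e0 = 2"
          using G by (auto simp: simple_graph_def)
        then show ?thesis
          using 1 by (auto simp: card_image[OF inj_on_subset[OF inj_emb]]) (auto simp: emb_def)
      next
        case 2
        have "emb i k \<noteq> emb (nxt i) (k + h)"
          using 2 nxt_less[of i] by (auto simp: emb_eq_iff)
        then show ?thesis
          using 2 nxt_less[of i] by (auto simp: cross_def emb_def)
      qed
    qed
    then show ?thesis by (simp add: simple_graph_def)
  qed
  have "degree ({..<3 * (2 * h)}, E') x = Suc d" if x: "x < 3 * (2 * h)" for x
  proof -
    obtain i v where iv: "i < 3" "v < 2 * h" "x = emb i v"
      by (rule emb_cases[OF x])
    have "degree ({..<2 * h}, E) v = d"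
      using reg iv(2) by (simp add: regular_def)
    then show ?thesis
      using degree_three_copies[OF G iv(1,2)] iv(3) by (simp add: E'_def)
  qed
  then have reg': "regular (Suc d) ({..<3 * (2 * h)}, E')"
    by (simp add: regular_def)
  have con: "connected_spanning ({..<3 * (2 * h)}, E') (sym_diff (A' S) (A' T))"
    if ST: "S \<subseteq> {..d}" "T \<subseteq> {..d}" "S \<noteq> T" for S T
  proof -
    define R where "R = sym_diff (A' S) (A' T)"
    have copy_iff: "emb i ` e \<in> A' S \<longleftrightarrow> e \<in> B i (S - {i})" if "i < 3" "e \<noteq> {}" for i e S
    proof -
      have "emb i ` e \<in> copies (word S) \<longleftrightarrow> e \<in> word S i"
        using word ne that by (intro emb_image_in_copies) blast+
      then show ?thesis
        using that emb_image_not_in_crosses[OF that(1)] by (simp add: A'_def word_def)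
    qed
    have cross_iff: "cross h k i \<in> A' S \<longleftrightarrow> form k i S" if "i < 3" "k < h" for i k S
      using that cross_not_in_copies cross_in_crosses[of k h i "\<lambda>k i. form k i S"] by (simp add: A'_def)
    have "(x, y) \<in> (adj R)\<^sup>*" if "x < 3 * (2 * h)" "y < 3 * (2 * h)" for x y
    proof (rule connected_three_copies[OF d h ST _ _ that])
      show "cross h k i \<in> R" if "i < 3" "k < h" "form k i S \<noteq> form k i T" for k i
        using that cross_iff by (auto simp: R_def)
    next
      fix i u v
      assume i: "i < 3" "S - {i} \<noteq> T - {i}" and uv: "u < 2 * h" "v < 2 * h"
      define Q where "Q = sym_diff (B i (S - {i})) (B i (T - {i}))"
      have "S - {i} \<subseteq> {..d} - {i}" "T - {i} \<subseteq> {..d} - {i}"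
        using ST by auto
      then have "connected_spanning ({..<2 * h}, E) Q"
        unfolding Q_def using B[OF i(1)] i(2) by (simp add: full_code_def)
      then have "(u, v) \<in> (adj Q)\<^sup>*"
        using uv by (simp add: connected_spanning_adj)
      then show "(emb i u, emb i v) \<in> (adj R)\<^sup>*"
      proof (induction rule: rtrancl_induct)
        case (step y z)
        then have "{y, z} \<in> Q" by (simp add: adj_def)
        then have "emb i ` {y, z} \<in> R"
          using copy_iff[OF i(1), of "{y, z}"] by (simp add: Q_def R_def)
        then have "(emb i y, emb i z) \<in> adj R" by (simp add: adj_def)
        with step.IH show ?case by (rule rtrancl_into_rtrancl)
      qed simp
    qed
    then show ?thesis
      using sub by (auto simp: connected_spanning_adj R_def)
  qed
  have "full_code (Suc d) (3 * (2 * h)) E' A' {..<Suc d}"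
    unfolding full_code_def lessThan_Suc_atMost using simple reg' sub con by blast
  then show ?thesis by blast
qed

lemma full_code_quartic:
  assumes "N \<ge> 2"
  shows "full_code 4 (4 * N) (shift_edges N quartic_steps) (\<lambda>S. shift_edges N (quartic_word S)) {..<4}"
  unfolding full_code_def
  using assms simple_shift_graph[OF assms, of quartic_steps] regular_quartic[OF assms] connected_quartic[OF assms]
    shift_edges_mono[OF quartic_word_subset]
  by (simp add: shift_graph_def)

text \<open>Induction from the circulant graph, with \<open>M\<close> general because each step
  needs \<open>h > d\<close>. The order stays even, as the matchings between halves require.\<close>

lemma full_code_exists:
  assumes "d \<ge> 4"
  shows "\<exists>h E A. h \<ge> M \<and> full_code d (2 * h) E A {..<d}"
  using assms
proof (induction d arbitrary: M rule: dec_induct)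
  case base
  have "full_code 4 (2 * (2 * (M + 2))) (shift_edges (M + 2) quartic_steps)
    (\<lambda>S. shift_edges (M + 2) (quartic_word S)) {..<4}"
    using full_code_quartic[of "M + 2"] by (simp only: mult.assoc[symmetric]) simp
  moreover have "2 * (M + 2) \<ge> M" by simp
  ultimately show ?case by blast
next
  case (step d)
  \<comment> \<open>The bound \<open>Suc d\<close> provides \<open>h > d\<close> for
    \<open>full_code_Suc\<close>.\<close>
  obtain h E A where h: "h \<ge> max M (Suc d)" "full_code d (2 * h) E A {..<d}"
    using step.IH by blast
  then obtain E' A' where "full_code (Suc d) (3 * (2 * h)) E' A' {..<Suc d}"
    using full_code_Suc[OF h(2)] step.hyps by auto
  then have "full_code (Suc d) (2 * (3 * h)) E' A' {..<Suc d}"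
    by (simp add: mult.left_commute)
  moreover have "3 * h \<ge> M" using h(1) by simp
  ultimately show ?case by blast
qed

section \<open>The values of \<open>f\<close>\<close>

lemma two_in_recurrent: "2 \<in> recurrent_max_codes 2"
proof (rule recurrent_max_codesI)
  fix M
  show "\<exists>G :: nat graph. simple_graph G \<and> regular 2 G \<and> max_code G = 2 \<and> card (verts G) \<ge> M"
    using simple_shift_graph[of "M + 2" cycle_steps] regular_cycle[of "M + 2"] max_code_cycle[of "M + 2"]
    by (intro exI[of _ "shift_graph (M + 2) cycle_steps"]) simp
qed

lemma four_in_recurrent: "4 \<in> recurrent_max_codes 3"
proof (rule recurrent_max_codesI)
  fix M
  show "\<exists>G :: nat graph. simple_graph G \<and> regular 3 G \<and> max_code G = 4 \<and> card (verts G) \<ge> M"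
    using simple_shift_graph[of "M + 3" cubic_steps] regular_cubic[of "M + 3"] max_code_cubic[of "M + 3"]
    by (intro exI[of _ "shift_graph (M + 3) cubic_steps"]) simp
qed

lemma power_in_recurrent:
  assumes "d \<ge> 4"
  shows "2 ^ d \<in> recurrent_max_codes d"
proof (rule recurrent_max_codesI)
  fix M
  obtain h E A where h: "h \<ge> M + 1" and full: "full_code d (2 * h) E A {..<d}"
    using full_code_exists[OF assms] by blast
  \<comment> \<open>The bound \<open>h \<ge> M + 1\<close> also guarantees the two vertices that
    make the words distinct.\<close>
  have "max_code ({..<2 * h}, E) = 2 ^ d"
    using full_code_max_code[OF full] h assms by simp
  then show "\<exists>G :: nat graph. simple_graph G \<and> regular d G \<and> max_code G = 2 ^ d \<and> card (verts G) \<ge> M"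
    using full h unfolding full_code_def by (intro exI[of _ "({..<2 * h}, E)"]) simp
qed

lemma recurrent_max_codes_le_power:
  assumes "d > 0"
  shows "recurrent_max_codes d \<subseteq> {..2 ^ d}"
proof
  fix q assume "q \<in> recurrent_max_codes d"
  then obtain G :: "nat graph" where "simple_graph G" "regular d G" "max_code G = q"
    by (rule recurrent_max_codesE[where n = 0])
  then show "q \<in> {..2 ^ d}"
    using max_code_le_power[of G d] assms by simp
qed

lemma f_max_eqI:
  assumes "q \<in> recurrent_max_codes d" "\<And>r. r \<in> recurrent_max_codes d \<Longrightarrow> r \<le> q"
  shows "f_max d = q"
  unfolding f_max_def
proof (rule Max_eqI)
  show "finite (recurrent_max_codes d)"
    by (rule finite_subset[of _ "{..q}"]) (use assms(2) in auto)
qed (use assms in auto)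

theorem corollary1p3:
  shows "(\<forall>d\<ge>2. finite (recurrent_max_codes d) \<and> recurrent_max_codes d \<noteq> {}) \<and>
    f_max 2 = 2 \<and> f_max 3 = 4 \<and> (\<forall>d\<ge>4. f_max d = 2 ^ d)"
proof (intro conjI allI impI)
  fix d :: nat assume d: "d \<ge> 2"
  show "finite (recurrent_max_codes d)"
    by (rule finite_subset[OF recurrent_max_codes_le_power]) (use d in simp_all)
  from d consider "d = 2" | "d = 3" | "d \<ge> 4" by linarith
  then show "recurrent_max_codes d \<noteq> {}"
    by cases (use two_in_recurrent four_in_recurrent power_in_recurrent in blast)+
next
  show "f_max 2 = 2"
  proof (rule f_max_eqI[OF two_in_recurrent])
    fix r assume "r \<in> recurrent_max_codes 2"
    \<comment> \<open>An infinite nonisomorphic family contains graphs of arbitrarily large order,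
      so one beyond the small exceptions can be taken.\<close>
    then obtain G :: "nat graph"
      where "simple_graph G" "regular 2 G" "max_code G = r" "card (verts G) > 3"
      by (rule recurrent_max_codesE)
    then show "r \<le> 2" using max_code_le_two[of G] by simp
  qed
next
  show "f_max 3 = 4"
  proof (rule f_max_eqI[OF four_in_recurrent])
    fix r assume "r \<in> recurrent_max_codes 3"
    then obtain G :: "nat graph"
      where "simple_graph G" "regular 3 G" "max_code G = r" "card (verts G) > 10"
      by (rule recurrent_max_codesE)
    then show "r \<le> 4" using max_code_le_four[of G] by simp
  qed
next
  fix d :: nat assume d: "d \<ge> 4"
  show "f_max d = 2 ^ d"
  proof (rule f_max_eqI[OF power_in_recurrent[OF d]])
    fix r assume "r \<in> recurrent_max_codes d"
    moreover have "d > 0" using d by simp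
    ultimately show "r \<le> 2 ^ d"
      using recurrent_max_codes_le_power by blast
  qed
qed

end
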